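(* Let $k$ be a positive integer that cannot be written as the sum of three integer squares. Then for every odd positive integer $n$ there does not exist a skew-symmetric weighing matrix $W(4n,k)$.
   Context: A weighing matrix $W(m,k)$ of order $m$ and weight $k$ is a square matrix $W$ of order $m$ with entries in $\{0,\pm1\}$ such that $WW^{\rm T}=kI_m$. A square matrix $A$ is skew-symmetric if $A^{\rm T}=-A$. *)

theory Defs
  imports "Jordan_Normal_Form.Matrix"
begin

definition weighing_matrix :: "nat \<Rightarrow> nat \<Rightarrow> int mat \<Rightarrow> bool" where
  "weighing_matrix m k W \<longleftrightarrow>
     W \<in> carrier_mat m m \<and> elements_mat W \<subseteq> {-1, 0, 1} \<and>
     W * transpose_mat W = of_nat k \<cdot>\<^sub>m 1\<^sub>m m"

definition skew_symmetric_mat :: "'a::uminus mat \<Rightarrow> bool" where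
  "skew_symmetric_mat A \<longleftrightarrow> square_mat A \<and> transpose_mat A = - A"

end

theory Submission
  imports Defs "HOL-Computational_Algebra.Primes"
begin

text \<open>
  Over the rationals, a skew-symmetric weighing matrix \<open>W\<close> of weight \<open>k\<close> satisfies
  \<open>\<langle>W x, y\<rangle> = - \<langle>x, W y\<rangle>\<close> and \<open>\<langle>W x, W y\<rangle> = k \<langle>x, y\<rangle>\<close>. As \<open>k\<close> is a sum of four rational squares,
  quaternion multiplication gives \<open>4 \<langle>1\<rangle> \<cong> 4 \<langle>k\<rangle>\<close>. Let \<open>n = 2 m + 1\<close>. By Witt's theorem one can
  successively choose unit vectors \<open>f\<^sub>0, \<dots>, f\<^sub>4\<^sub>m\<close> such that all the \<open>f\<^sub>i\<close> and \<open>W f\<^sub>i\<close> are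
  pairwise orthogonal. The first \<open>4 m\<close> of the vectors \<open>W f\<^sub>i\<close> span a copy of \<open>4 m \<langle>k\<rangle> \<cong> 4 m \<langle>1\<rangle>\<close>,
  so, by Witt again, the orthogonal complement of these and of the \<open>f\<^sub>i\<close> is a copy of \<open>3 \<langle>1\<rangle>\<close>. It
  contains \<open>W f\<^sub>4\<^sub>m\<close>, of norm \<open>k\<close>, which makes \<open>k\<close> a sum of three rational squares, hence (Davenport
  and Cassels) of three integer squares.
\<close>

section \<open>Sums of three and four squares\<close>

text \<open>Davenport-Cassels descent on the denominator \<open>t\<close>: from a rational point on
  the sphere of squared radius \<open>k\<close>, a chord through a nearby integer point leads to a
  rational point with smaller denominator, until the point is integral.\<close>

lemma scaled_sum_three_squares_imp_int:
  fixes k :: int and t :: nat and a b c :: int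
  assumes "t > 0" "int t ^ 2 * k = a^2 + b^2 + c^2"
  shows "\<exists>x y z :: int. k = x^2 + y^2 + z^2"
  using assms
proof (induction t arbitrary: a b c rule: less_induct)
  case (less t)
  define T where "T = int t"
  have T: "T > 0" using less.prems by (simp add: T_def)
  \<comment> \<open>Centred division: \<open>u\<close> is the floor of \<open>x / T + 1 / 2\<close>,
    with everything doubled to stay in the integers, so the remainder is at most
    \<open>T / 2\<close> in absolute value.\<close>
  have nearest: "\<exists>u r. x = T * u + r \<and> 4 * r^2 \<le> T^2" for x :: int
  proof -
    define u where "u = (2 * x + T) div (2 * T)"
    define s where "s = (2 * x + T) mod (2 * T)"
    have s: "0 \<le> s" "s < 2 * T" "2 * x + T = 2 * T * u + s"
      using T by (simp_all add: s_def u_def)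
    have "\<bar>2 * (x - T * u)\<bar> \<le> \<bar>T\<bar>" using s by (simp add: algebra_simps)
    then have "4 * (x - T * u)^2 \<le> T^2"
      unfolding abs_le_square_iff power_mult_distrib by simp
    then show ?thesis by (metis add_diff_cancel_left' diff_add_cancel add.commute)
  qed
  obtain u r v s w q where
    a: "a = T * u + r" "4 * r^2 \<le> T^2" and b: "b = T * v + s" "4 * s^2 \<le> T^2" and
    c: "c = T * w + q" "4 * q^2 \<le> T^2"
    using nearest[of a] nearest[of b] nearest[of c] by blast
  have eq: "T^2 * k = a^2 + b^2 + c^2" using less.prems by (simp add: T_def)
  txt \<open>The second intersection of the sphere with the line through \<open>(a, b, c) / T\<close> and the nearby
    integer point \<open>(u, v, w)\<close> has denominator \<open>T' < T\<close>.\<close>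
  define A where "A = u^2 + v^2 + w^2 - k"
  define B where "B = 2 * (k * T - (a * u + b * v + c * w))"
  define T' where "T' = T * A + B"
  \<comment> \<open>This identity gives both \<open>T' \<ge> 0\<close> and, as the three remainders
    satisfy \<open>4 * T * T' \<le> 3 * T^2\<close>, the strict decrease
    \<open>T' < T\<close>.\<close>
  have TT': "T * T' = r^2 + s^2 + q^2"
  proof -
    have "r^2 + s^2 + q^2
        = (a^2 + b^2 + c^2) - 2 * T * (a * u + b * v + c * w) + T^2 * (u^2 + v^2 + w^2)"
      unfolding a(1) b(1) c(1) by (simp add: power2_eq_square algebra_simps)
    also have "\<dots> = T * T'"
      unfolding eq[symmetric] T'_def A_def B_def by (simp add: power2_eq_square algebra_simps)
    finally show ?thesis ..
  qed
  \<comment> \<open>With P = (a, b, c) / T and Q = (u, v, w), the new point is the affine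
    combination of P and Q with weights \<open>T * A\<close> and \<open>B\<close>. Here A = |Q|^2 -
    k and B = 2 T (k - P.Q), which is what puts the combination back on the sphere.\<close>
  have new: "T'^2 * k = (A * a + B * u)^2 + (A * b + B * v)^2 + (A * c + B * w)^2"
  proof -
    have "(A * a + B * u)^2 + (A * b + B * v)^2 + (A * c + B * w)^2
        = A^2 * (a^2 + b^2 + c^2) + A * B * (2 * (a * u + b * v + c * w)) + B^2 * (u^2 + v^2 + w^2)"
      by (simp add: power2_eq_square algebra_simps)
    also have "\<dots> = A^2 * (T^2 * k) + A * B * (2 * k * T - B) + B^2 * (A + k)"
      by (simp add: eq) (simp add: A_def B_def)
    also have "\<dots> = T'^2 * k"
      unfolding T'_def by (simp add: power2_eq_square algebra_simps)
    finally show ?thesis ..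
  qed
  show ?case
  proof (cases "T' = 0")
    case True
    \<comment> \<open>All remainders vanish, so the given point is already integral.\<close>
    then have "r = 0 \<and> s = 0 \<and> q = 0"
      using TT' by (simp add: add_nonneg_eq_0_iff)
    then have "T^2 * k = T^2 * (u^2 + v^2 + w^2)"
      using eq by (simp add: a(1) b(1) c(1) power_mult_distrib distrib_left)
    then show ?thesis using T by auto
  next
    case False
    have "0 \<le> T * T'" unfolding TT' by simp
    then have pos: "T' > 0" using T False by (simp add: zero_le_mult_iff)
    have "4 * (T * T') < 4 * (T * T)" using TT' a b c T
      by (smt (verit) power2_eq_square zero_less_power2)
    then have "T' < T" using T by simp
    then have "nat T' < t" using pos by (simp add: T_def)
    moreover have "int (nat T') ^ 2 * k = (A * a + B * u)^2 + (A * b + B * v)^2 + (A * c + B * w)^2"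
      using new pos by simp
    ultimately show ?thesis using less.IH[of "nat T'"] pos by auto
  qed
qed

lemma rat_sum_three_squares_imp_int:
  fixes k :: int and x y z :: rat
  assumes "of_int k = x^2 + y^2 + z^2"
  shows "\<exists>a b c :: int. k = a^2 + b^2 + c^2"
proof -
  have frac: "\<exists>(a::int) (d::nat). x = of_int a / of_nat d \<and> d > 0" for x :: rat
  proof -
    obtain a d where "x = Fract a d" "d > 0" by (cases x)
    then show ?thesis by (intro exI[of _ a] exI[of _ "nat d"]) (simp add: Fract_of_int_quotient)
  qed
  obtain a b c :: int and d e f :: nat where
    x: "x = of_int a / of_nat d" "d > 0" and y: "y = of_int b / of_nat e" "e > 0" and
    z: "z = of_int c / of_nat f" "f > 0"
    using frac[of x] frac[of y] frac[of z] by blast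
  have "(of_int (int (d * e * f) ^ 2 * k) :: rat)
      = of_int ((a * int (e * f))^2 + (b * int (d * f))^2 + (c * int (d * e))^2)"
    using x(2) y(2) z(2) by (simp add: assms x(1) y(1) z(1) field_simps power2_eq_square)
  then have "int (d * e * f) ^ 2 * k = (a * int (e * f))^2 + (b * int (d * f))^2 + (c * int (d * e))^2"
    by (simp only: of_int_eq_iff)
  then show ?thesis
    using scaled_sum_three_squares_imp_int[of "d * e * f"] x y z by simp
qed

section \<open>Sums of four squares over the rationals\<close>

definition sum_four_squares :: "'a::comm_ring_1 \<Rightarrow> bool" where
  "sum_four_squares x \<longleftrightarrow> (\<exists>a b c d. x = a^2 + b^2 + c^2 + d^2)"

text \<open>Euler's identity, i.e. multiplicativity of the quaternion norm.\<close>

lemma sum_four_squares_mult: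
  assumes "sum_four_squares x" "sum_four_squares y"
  shows "sum_four_squares (x * y)"
proof -
  obtain a b c d e f g h where "x = a^2 + b^2 + c^2 + d^2" "y = e^2 + f^2 + g^2 + h^2"
    using assms by (auto simp: sum_four_squares_def)
  then have "x * y = (a*e + b*f + c*g + d*h)^2 + (a*f - b*e + c*h - d*g)^2
      + (a*g - b*h - c*e + d*f)^2 + (a*h + b*g - c*f - d*e)^2"
    by (simp add: power2_eq_square algebra_simps)
  then show ?thesis unfolding sum_four_squares_def by blast
qed

lemma sum_four_squares_divide:
  fixes x y :: "'a::field"
  assumes "sum_four_squares x" "sum_four_squares y"
  shows "sum_four_squares (x / y)"
proof -
  have "sum_four_squares ((1 / y)^2)"
    unfolding sum_four_squares_def
    by (rule exI[of _ "1 / y"], rule exI[of _ 0], rule exI[of _ 0], rule exI[of _ 0]) simp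
  then have "sum_four_squares (x * y * (1 / y)^2)"
    using assms by (intro sum_four_squares_mult)
  \<comment> \<open>For \<open>y = 0\<close> both sides are 0, since division by zero yields
    0.\<close>
  moreover have "x * y * (1 / y)^2 = x / y" by (simp add: power2_eq_square)
  ultimately show ?thesis by metis
qed

text \<open>Pigeonhole: with \<open>p = 2 * h + 1\<close>, the residues of \<open>x^2\<close> and of
  \<open>- 1 - y^2\<close> for arguments in \<open>{0..h}\<close> form two sets of
  \<open>h + 1\<close> elements each, too many to be disjoint modulo \<open>p\<close>. The bounds on
  \<open>x\<close> and \<open>y\<close> serve to make the cofactor of \<open>p\<close> smaller than
  \<open>p\<close>.\<close>

lemma prime_dvd_sum_two_squares_plus_one:
  fixes p :: int
  assumes "prime p" "odd p"
  shows "\<exists>x y. 0 \<le> x \<and> 2 * x < p \<and> 0 \<le> y \<and> 2 * y < p \<and> p dvd x^2 + y^2 + 1"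
proof -
  define h where "h = (p - 1) div 2"
  have p: "p = 2 * h + 1" "h \<ge> 0" using assms prime_gt_0_int[of p] by (auto simp: h_def elim!: oddE)
  have inj: "x = y" if "x \<in> {0..h}" "y \<in> {0..h}" "p dvd x^2 - y^2" for x y
  proof -
    have "p dvd (x - y) * (x + y)" using that(3) by (simp add: power2_eq_square algebra_simps)
    then consider "p dvd x - y" | "p dvd x + y" using assms prime_dvd_multD by blast
    then show ?thesis
    proof cases
      case 1
      then show ?thesis using that p zdvd_not_zless[of "x - y" p] zdvd_not_zless[of "y - x" p]
        by (smt (verit) atLeastAtMost_iff dvd_diff_commute)
    next
      case 2
      then show ?thesis using that p zdvd_not_zless[of "x + y" p] by (smt (verit) atLeastAtMost_iff)
    qed
  qed
  define S where "S = (\<lambda>x. x^2 mod p) ` {0..h}"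
  define S' where "S' = (\<lambda>y. (- 1 - y^2) mod p) ` {0..h}"
  have "inj_on (\<lambda>x. x^2 mod p) {0..h}"
    by (rule inj_onI) (use inj mod_eq_dvd_iff in blast)
  then have S: "card S = nat (h + 1)" by (simp add: S_def card_image)
  have "inj_on (\<lambda>y. (- 1 - y^2) mod p) {0..h}"
  proof (rule inj_onI)
    fix x y assume xy: "x \<in> {0..h}" "y \<in> {0..h}" "(- 1 - x^2) mod p = (- 1 - y^2) mod p"
    then have "p dvd y^2 - x^2" by (simp add: mod_eq_dvd_iff)
    then show "x = y" using inj xy by blast
  qed
  then have S': "card S' = nat (h + 1)" by (simp add: S'_def card_image)
  have "S \<inter> S' \<noteq> {}"
  proof
    assume "S \<inter> S' = {}"
    then have "card (S \<union> S') = nat (h + 1) + nat (h + 1)"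
      using S S' by (subst card_Un_disjoint) (auto simp: S_def S'_def)
    moreover have "S \<union> S' \<subseteq> {0..<p}" using prime_gt_0_int[OF assms(1)] by (auto simp: S_def S'_def)
    then have "card (S \<union> S') \<le> nat p" using card_mono[of "{0..<p}"] by simp
    ultimately show False using p by simp
  qed
  then obtain x y where "x \<in> {0..h}" "y \<in> {0..h}" "x^2 mod p = (- 1 - y^2) mod p"
    unfolding S_def S'_def by blast
  moreover from this have "p dvd x^2 + y^2 + 1" by (simp add: mod_eq_dvd_iff algebra_simps)
  ultimately show ?thesis using p by (intro exI[of _ x] exI[of _ y]) auto
qed

text \<open>Since sums of four squares in a field are closed under division, a prime \<open>p\<close> reduces to the
  smaller cofactor \<open>(x\<^sup>2 + y\<^sup>2 + 1) / p\<close>, and Lagrange's descent is not needed.\<close>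

lemma rat_of_nat_sum_four_squares: "sum_four_squares (of_nat k :: rat)"
proof (induction k rule: less_induct)
  case (less k)
  have triv: "sum_four_squares (a^2 + b^2 + 1 :: rat)" for a b
    unfolding sum_four_squares_def
    by (rule exI[of _ a], rule exI[of _ b], rule exI[of _ 1], rule exI[of _ 0]) simp
  consider "k = 0" | "k = 1" | "k = 2" | "k > 2" "prime k" | "k > 1" "\<not> prime k" by linarith
  then show ?case
  proof cases
    case 1
    then show ?thesis by (auto simp: sum_four_squares_def intro!: exI[of _ 0])
  next
    case 2
    then show ?thesis using triv[of 0 0] by simp
  next
    case 3
    then show ?thesis using triv[of 1 0] by simp
  next
    case 4
    then have "prime (int k)" "odd (int k)" using prime_odd_nat by auto
    then obtain x y where xy: "0 \<le> x" "2 * x < int k" "0 \<le> y" "2 * y < int k"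
      "int k dvd x^2 + y^2 + 1"
      using prime_dvd_sum_two_squares_plus_one by blast
    then obtain j where j: "x^2 + y^2 + 1 = int k * j" by blast
    \<comment> \<open>Size estimate showing \<open>j < k\<close>, so that the induction hypothesis
      covers the cofactor \<open>j\<close>.\<close>
    have "(2 * x)^2 \<le> (int k - 1)^2" "(2 * y)^2 \<le> (int k - 1)^2"
      using xy by (intro power_mono; simp)+
    then have "4 * (x^2 + y^2 + 1) \<le> 2 * (int k - 1)^2 + 4" by (simp add: power_mult_distrib)
    also have "\<dots> < 4 * (int k * int k)"
    proof -
      have "int k * int k > 2 * 2" using 4 by (intro mult_strict_mono) auto
      then show ?thesis using 4 by (simp add: power2_eq_square algebra_simps)
    qed
    finally have "int k * j < int k * int k" using j by simp
    then have "j < int k" using 4 by simp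
    have "int k * j > 0" using j[symmetric] by (simp add: add_nonneg_pos)
    then have "j > 0" using 4 by (simp add: zero_less_mult_iff)
    have "sum_four_squares (of_nat (nat j) :: rat)" using \<open>j < int k\<close> \<open>j > 0\<close> 4 by (intro less) auto
    then have "sum_four_squares (((of_int x)^2 + (of_int y)^2 + 1) / of_int j :: rat)"
      using \<open>j > 0\<close> by (intro sum_four_squares_divide triv) auto
    moreover have "((of_int x)^2 + (of_int y)^2 + 1) / of_int j = (of_nat k :: rat)"
    proof -
      have "(of_int (x^2 + y^2 + 1) :: rat) = of_int (int k * j)" using j by simp
      then show ?thesis using \<open>j > 0\<close> by (simp add: field_simps)
    qed
    ultimately show ?thesis by metis
  next
    case 5
    then obtain a b where "k = a * b" "a < k" "b < k"
      by (metis prime_product mult_cancel2 nat_dvd_not_less not_less_iff_gr_or_eq prime_nat_iff dvdE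
          dvd_triv_right nat_mult_1 bot_nat_0.not_eq_extremum mult.right_neutral dvd_imp_le)
    then show ?thesis using less by (auto intro: sum_four_squares_mult)
  qed
qed

section \<open>Witt extension\<close>

text \<open>Over an ordered field a sum of squares vanishes only termwise. Hence every nonzero
  vector is anisotropic and defines a reflection.\<close>

lemma scalar_prod_self_eq_0_iff:
  fixes v :: "'a::linordered_field vec"
  assumes "v \<in> carrier_vec n"
  shows "v \<bullet> v = 0 \<longleftrightarrow> v = 0\<^sub>v n"
proof
  assume "v \<bullet> v = 0"
  then have "\<forall>i<n. v $ i * v $ i = 0"
    using assms by (auto simp: scalar_prod_def sum_nonneg_eq_0_iff)
  then show "v = 0\<^sub>v n" using assms by (intro eq_vecI) auto
qed (use assms in auto)

text \<open>The reflection in the hyperplane orthogonal to \<open>c - b\<close> carries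
  \<open>c\<close> to \<open>b\<close>, because the two have equal norm. It fixes exactly the
  vectors orthogonal to \<open>c - b\<close>.\<close>

lemma ex_reflection:
  fixes b c :: "'a::linordered_field vec"
  assumes b[simp]: "b \<in> carrier_vec n" and c[simp]: "c \<in> carrier_vec n" and eq: "c \<bullet> c = b \<bullet> b"
  obtains \<rho> where "\<And>x. x \<in> carrier_vec n \<Longrightarrow> \<rho> x \<in> carrier_vec n"
    "\<And>x y. x \<in> carrier_vec n \<Longrightarrow> y \<in> carrier_vec n \<Longrightarrow> \<rho> x \<bullet> \<rho> y = x \<bullet> y"
    "\<rho> c = b" "\<And>x. x \<in> carrier_vec n \<Longrightarrow> x \<bullet> c = x \<bullet> b \<Longrightarrow> \<rho> x = x"
proof (cases "c = b")
  case True
  then show ?thesis using that[of id] by simp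
next
  case False
  define w where "w = c - b"
  define \<rho> where "\<rho> x = x - (2 * (x \<bullet> w) / (w \<bullet> w)) \<cdot>\<^sub>v w" for x
  have w[simp]: "w \<in> carrier_vec n" by (simp add: w_def)
  have "w \<noteq> 0\<^sub>v n"
  proof
    assume "w = 0\<^sub>v n"
    then have "c $ i - b $ i = 0" if "i < n" for i
      using that carrier_vecD[OF b] by (metis w_def index_minus_vec(1) index_zero_vec(1))
    then have "c = b" by (intro eq_vecI) (simp_all add: carrier_vecD[OF b] carrier_vecD[OF c])
    then show False using False by contradiction
  qed
  then have ww: "w \<bullet> w \<noteq> 0" by (simp add: scalar_prod_self_eq_0_iff[of _ n])
  have comm: "x \<bullet> y = y \<bullet> x" if "x \<in> carrier_vec n" "y \<in> carrier_vec n" for x y :: "'a vec"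
    using that by (rule comm_scalar_prod)
  show ?thesis
  proof (rule that[of \<rho>])
    show "\<rho> x \<in> carrier_vec n" if "x \<in> carrier_vec n" for x using that by (simp add: \<rho>_def)
    show "\<rho> x \<bullet> \<rho> y = x \<bullet> y" if x[simp]: "x \<in> carrier_vec n" and y[simp]: "y \<in> carrier_vec n" for x y
    proof -
      define s t where "s = 2 * (x \<bullet> w) / (w \<bullet> w)" and "t = 2 * (y \<bullet> w) / (w \<bullet> w)"
      have "\<rho> x \<bullet> \<rho> y = (x - s \<cdot>\<^sub>v w) \<bullet> (y - t \<cdot>\<^sub>v w)"
        by (simp only: \<rho>_def s_def t_def)
      also have "\<dots> = x \<bullet> y - t * (x \<bullet> w) - s * (y \<bullet> w) + s * t * (w \<bullet> w)"
        using comm[of w y] smult_scalar_prod_distrib[OF w y, of s]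
        by (simp add: minus_scalar_prod_distrib[of _ n]
            scalar_prod_minus_distrib[of _ n] algebra_simps)
      also have "\<dots> = x \<bullet> y" using ww by (simp add: s_def t_def field_simps)
      finally show ?thesis .
    qed
    \<comment> \<open>Equal norms make the reflection coefficient of \<open>c\<close> equal to
      1.\<close>
    have "w \<bullet> w = 2 * (c \<bullet> w)"
      using comm[of b c] eq
      by (simp add: w_def minus_scalar_prod_distrib[of _ n] scalar_prod_minus_distrib[of _ n])
    then have "\<rho> c = c - w" using ww by (simp add: \<rho>_def)
    then show "\<rho> c = b"
      using carrier_vecD[OF b] carrier_vecD[OF c] by (auto simp: w_def intro!: eq_vecI)
    show "\<rho> x = x" if "x \<in> carrier_vec n" "x \<bullet> c = x \<bullet> b" for x
    proof -
      have "x \<bullet> w = 0" using that by (simp add: w_def scalar_prod_minus_distrib[of _ n])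
      then show ?thesis using that by (auto simp: \<rho>_def carrier_vecD[OF w] intro!: eq_vecI)
    qed
  qed
qed

text \<open>Witt's theorem for two families with the same Gram matrix, by adding one vector at a
  time: after \<open>I\<close> has been matched, one more reflection moves the image of
  \<open>a r\<close> to \<open>b r\<close>. The isometry is recorded only as a map preserving scalar
  products, which is all that later steps use.\<close>

lemma witt_extension:
  fixes a b :: "'i \<Rightarrow> 'a::linordered_field vec"
  assumes "finite I" "\<And>i. i \<in> I \<Longrightarrow> a i \<in> carrier_vec n" "\<And>i. i \<in> I \<Longrightarrow> b i \<in> carrier_vec n"
    and "\<And>i j. i \<in> I \<Longrightarrow> j \<in> I \<Longrightarrow> a i \<bullet> a j = b i \<bullet> b j"
  obtains \<sigma> where "\<And>x. x \<in> carrier_vec n \<Longrightarrow> \<sigma> x \<in> carrier_vec n"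
    "\<And>x y. x \<in> carrier_vec n \<Longrightarrow> y \<in> carrier_vec n \<Longrightarrow> \<sigma> x \<bullet> \<sigma> y = x \<bullet> y"
    "\<And>i. i \<in> I \<Longrightarrow> \<sigma> (a i) = b i"
proof -
  have "\<exists>\<sigma>. (\<forall>x\<in>carrier_vec n. \<sigma> x \<in> carrier_vec n) \<and>
      (\<forall>x\<in>carrier_vec n. \<forall>y\<in>carrier_vec n. \<sigma> x \<bullet> \<sigma> y = x \<bullet> y) \<and> (\<forall>i\<in>I. \<sigma> (a i) = b i)"
    using assms
  proof (induction I rule: finite_induct)
    case empty
    then show ?case by (intro exI[of _ id]) simp
  next
    case (insert r I)
    have "\<exists>\<sigma>. (\<forall>x\<in>carrier_vec n. \<sigma> x \<in> carrier_vec n) \<and>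
      (\<forall>x\<in>carrier_vec n. \<forall>y\<in>carrier_vec n. \<sigma> x \<bullet> \<sigma> y = x \<bullet> y) \<and> (\<forall>i\<in>I. \<sigma> (a i) = b i)"
      by (rule insert.IH) (simp_all add: insert.prems)
    then obtain \<sigma> where \<sigma>: "\<And>x. x \<in> carrier_vec n \<Longrightarrow> \<sigma> x \<in> carrier_vec n"
      "\<And>x y. x \<in> carrier_vec n \<Longrightarrow> y \<in> carrier_vec n \<Longrightarrow> \<sigma> x \<bullet> \<sigma> y = x \<bullet> y"
      "\<And>i. i \<in> I \<Longrightarrow> \<sigma> (a i) = b i"
      by blast
    have "\<sigma> (a r) \<bullet> \<sigma> (a r) = b r \<bullet> b r" using insert.prems \<sigma> by simp
    then obtain \<rho> where \<rho>: "\<And>x. x \<in> carrier_vec n \<Longrightarrow> \<rho> x \<in> carrier_vec n"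
      "\<And>x y. x \<in> carrier_vec n \<Longrightarrow> y \<in> carrier_vec n \<Longrightarrow> \<rho> x \<bullet> \<rho> y = x \<bullet> y"
      "\<rho> (\<sigma> (a r)) = b r" "\<And>x. x \<in> carrier_vec n \<Longrightarrow> x \<bullet> \<sigma> (a r) = x \<bullet> b r \<Longrightarrow> \<rho> x = x"
      using ex_reflection[of "b r" n "\<sigma> (a r)"] insert.prems(1,2)[OF insertI1] \<sigma>(1) by blast
    have "\<rho> (\<sigma> (a i)) = b i" if "i \<in> I" for i
    proof -
      \<comment> \<open>Equality of Gram entries is precisely the condition under which the new
        reflection fixes \<open>b i\<close>, so earlier matches survive.\<close>
      have "b i \<bullet> \<sigma> (a r) = b i \<bullet> b r"
        using \<sigma>(2)[of "a i" "a r"] \<sigma>(3)[OF that] insert.prems that by simp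
      then show ?thesis using \<rho>(4) \<sigma>(3)[OF that] insert.prems(2)[of i] that by simp
    qed
    then show ?case using \<rho> \<sigma> by (intro exI[of _ "\<rho> \<circ> \<sigma>"]) simp
  qed
  then show thesis using that by blast
qed

text \<open>Induction on \<open>J\<close>: the vectors \<open>f i\<close>, \<open>W (f i)\<close>
  found so far have the Gram matrix of the model vectors \<open>e i\<close>, \<open>g i\<close>. A
  Witt isometry from the model to them sends the fresh unit vector \<open>e J\<close> to the next
  \<open>f\<close>. The family \<open>e\<close> has one member more than \<open>g\<close>, since the
  last step needs a fresh unit vector but no model for its image under \<open>W\<close>.\<close>

lemma ex_orthonormal_with_orthogonal_images:
  fixes W :: "'a::linordered_field vec \<Rightarrow> 'a vec" and e g :: "nat \<Rightarrow> 'a vec"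
  assumes W: "\<And>x. x \<in> carrier_vec N \<Longrightarrow> W x \<in> carrier_vec N"
    and skew: "\<And>x y. x \<in> carrier_vec N \<Longrightarrow> y \<in> carrier_vec N \<Longrightarrow> W x \<bullet> y = - (x \<bullet> W y)"
    and sim: "\<And>x y. x \<in> carrier_vec N \<Longrightarrow> y \<in> carrier_vec N \<Longrightarrow> W x \<bullet> W y = k * (x \<bullet> y)"
    and e: "\<And>i. i \<le> K \<Longrightarrow> e i \<in> carrier_vec N" and g: "\<And>i. i < K \<Longrightarrow> g i \<in> carrier_vec N"
    and ee: "\<And>i j. i \<le> K \<Longrightarrow> j \<le> K \<Longrightarrow> e i \<bullet> e j = (if i = j then 1 else 0)"
    and gg: "\<And>i j. i < K \<Longrightarrow> j < K \<Longrightarrow> g i \<bullet> g j = (if i = j then k else 0)"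
    and eg: "\<And>i j. i \<le> K \<Longrightarrow> j < K \<Longrightarrow> e i \<bullet> g j = 0"
  shows "J \<le> Suc K \<Longrightarrow> \<exists>f. \<forall>i<J. f i \<in> carrier_vec N \<and>
    (\<forall>j<J. f i \<bullet> f j = (if i = j then 1 else 0) \<and> f i \<bullet> W (f j) = 0)"
proof (induction J)
  case 0
  then show ?case by simp
next
  case (Suc J)
  then obtain f where f: "\<And>i. i < J \<Longrightarrow> f i \<in> carrier_vec N"
    "\<And>i j. i < J \<Longrightarrow> j < J \<Longrightarrow> f i \<bullet> f j = (if i = j then 1 else 0)"
    "\<And>i j. i < J \<Longrightarrow> j < J \<Longrightarrow> f i \<bullet> W (f j) = 0"
    by (metis Suc_leD)
  have comm: "x \<bullet> y = y \<bullet> x" if "x \<in> carrier_vec N" "y \<in> carrier_vec N" for x y :: "'a vec"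
    using that by (rule comm_scalar_prod)
  have ge: "g j \<bullet> e i = 0" if "i \<le> K" "j < K" for i j
    using eg[OF that] comm[of "e i" "g j"] e g that by simp
  have Wf: "W (f i) \<bullet> f j = 0" if "i < J" "j < J" for i j
    using f that by (simp add: skew)
  obtain \<sigma> where \<sigma>: "\<And>x. x \<in> carrier_vec N \<Longrightarrow> \<sigma> x \<in> carrier_vec N"
    "\<And>x y. x \<in> carrier_vec N \<Longrightarrow> y \<in> carrier_vec N \<Longrightarrow> \<sigma> x \<bullet> \<sigma> y = x \<bullet> y"
    "\<And>i. i < J \<Longrightarrow> \<sigma> (e i) = f i" "\<And>i. i < J \<Longrightarrow> \<sigma> (g i) = W (f i)"
  \<comment> \<open>The disjoint sum of index sets merges both families into one: \<open>Inl\<close>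
    indexes the unit vectors, \<open>Inr\<close> the vectors of norm \<open>k\<close>.\<close>
  proof (rule witt_extension[of "{..<J} <+> {..<J}" "case_sum e g" N "case_sum f (\<lambda>i. W (f i))"])
    fix \<tau>
    assume \<tau>: "\<And>x. x \<in> carrier_vec N \<Longrightarrow> \<tau> x \<in> carrier_vec N"
      "\<And>x y. x \<in> carrier_vec N \<Longrightarrow> y \<in> carrier_vec N \<Longrightarrow> \<tau> x \<bullet> \<tau> y = x \<bullet> y"
      "\<And>i. i \<in> {..<J} <+> {..<J} \<Longrightarrow> \<tau> (case_sum e g i) = case_sum f (\<lambda>i. W (f i)) i"
    show thesis using that[OF \<tau>(1,2)] \<tau>(3)[of "Inl _"] \<tau>(3)[of "Inr _"] by auto
  qed (use Suc.prems in \<open>auto simp: e g f W Wf ee gg eg ge sim split: if_splits\<close>)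
  define h where "h = \<sigma> (e J)"
  have h: "h \<in> carrier_vec N" using e \<sigma> Suc.prems by (simp add: h_def)
  have hf: "h \<bullet> f i = 0" if "i < J" for i
    using \<sigma>(2)[of "e J" "e i"] \<sigma>(3)[of i] e ee[of J i] Suc.prems that by (simp add: h_def)
  have hW: "h \<bullet> W (f i) = 0" if "i < J" for i
    using \<sigma>(2)[of "e J" "g i"] \<sigma>(4)[of i] e g eg[of J i] Suc.prems that by (simp add: h_def)
  have hh: "h \<bullet> h = 1" using \<sigma>(2)[of "e J" "e J"] e ee[of J J] Suc.prems by (simp add: h_def)
  \<comment> \<open>By skewness this product equals its own negative.\<close>
  have Wh: "h \<bullet> W h = 0" using skew[OF h h] comm[OF h W[OF h]] by simp
  have fW: "f i \<bullet> W h = 0" if "i < J" for i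
    using skew[of "f i" h] comm[OF h W[of "f i"]] hW[of i] f that h by simp
  have fh: "f i \<bullet> h = 0" if "i < J" for i
    using comm[of h "f i"] hf[of i] f that h by simp
  show ?case
    by (intro exI[of _ "f(J := h)"]) (auto simp: less_Suc_eq f h hf hW hh Wh fW fh)
qed

section \<open>Quaternion blocks\<close>

text \<open>The matrix of multiplication by the quaternion \<open>a + b i + c j + d k\<close>, up to signs.\<close>

definition quat_entry :: "'a::comm_ring_1 \<Rightarrow> 'a \<Rightarrow> 'a \<Rightarrow> 'a \<Rightarrow> nat \<Rightarrow> nat \<Rightarrow> 'a" where
  "quat_entry a b c d r s = [[a, b, c, d], [- b, a, - d, c], [- c, d, a, - b], [- d, - c, b, a]] ! r ! s"

lemma less_4_cases: "(r::nat) < 4 \<longleftrightarrow> r = 0 \<or> r = 1 \<or> r = 2 \<or> r = 3" by auto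

lemma sum_lessThan_4: "(\<Sum>s<4. f s) = f 0 + f 1 + f 2 + f (3::nat)"
  by (simp add: numeral_eq_Suc)

lemma quat_entry_rows:
  "r < 4 \<Longrightarrow> r' < 4 \<Longrightarrow> (\<Sum>s<4. quat_entry a b c d r s * quat_entry a b c d r' s)
    = (if r = r' then a^2 + b^2 + c^2 + d^2 else 0)"
  unfolding less_4_cases sum_lessThan_4 quat_entry_def
  by (elim disjE) (simp_all add: power2_eq_square algebra_simps)

lemma quat_entry_cols:
  "s < 4 \<Longrightarrow> s' < 4 \<Longrightarrow> (\<Sum>r<4. quat_entry a b c d r s * quat_entry a b c d r s')
    = (if s = s' then a^2 + b^2 + c^2 + d^2 else 0)"
  unfolding less_4_cases sum_lessThan_4 quat_entry_def
  by (elim disjE) (simp_all add: power2_eq_square algebra_simps)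

text \<open>Multiplying by the transposed block turns the system into a scalar one, without
  inverting anything in the ring.\<close>

lemma quat_entry_kernel:
  assumes "\<And>r. r < 4 \<Longrightarrow> (\<Sum>s<4. quat_entry a b c d r s * x s) = 0" "s < 4"
  shows "(a^2 + b^2 + c^2 + d^2) * x s = 0"
proof -
  have "(\<Sum>r<4. quat_entry a b c d r s * (\<Sum>s'<4. quat_entry a b c d r s' * x s')) = 0"
    using assms(1) by simp
  then have "(\<Sum>s'<4. (\<Sum>r<4. quat_entry a b c d r s * quat_entry a b c d r s') * x s') = 0"
    unfolding sum_distrib_left sum_distrib_right by (subst sum.swap) (simp add: mult.assoc)
  also have "(\<Sum>s'<4. (\<Sum>r<4. quat_entry a b c d r s * quat_entry a b c d r s') * x s')
      = (\<Sum>s'<4. if s = s' then (a^2 + b^2 + c^2 + d^2) * x s' else 0)"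
    using assms(2) by (intro sum.cong) (auto simp: quat_entry_cols)
  finally show ?thesis using assms(2) by simp
qed

text \<open>These are rows of a block-diagonal matrix with equal 4 by 4 quaternion blocks. They
  realise orthogonal vectors of norm \<open>k\<close> inside the span of the leading
  coordinates.\<close>

definition quat_block_vec :: "nat \<Rightarrow> 'a::comm_ring_1 \<Rightarrow> 'a \<Rightarrow> 'a \<Rightarrow> 'a \<Rightarrow> nat \<Rightarrow> 'a vec" where
  "quat_block_vec N a b c d i =
    vec N (\<lambda>l. if l div 4 = i div 4 then quat_entry a b c d (i mod 4) (l mod 4) else 0)"

lemma quat_block_vec_scalar_prod:
  assumes "i < 4 * m" "4 * m \<le> N" "x \<in> carrier_vec N"
  shows "quat_block_vec N a b c d i \<bullet> x
    = (\<Sum>s<4. quat_entry a b c d (i mod 4) s * x $ (4 * (i div 4) + s))"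
proof -
  let ?h = "\<lambda>l. (if l div 4 = i div 4 then quat_entry a b c d (i mod 4) (l mod 4) else 0) * x $ l"
  have "quat_block_vec N a b c d i \<bullet> x = (\<Sum>l<N. ?h l)"
    using assms by (simp add: scalar_prod_def quat_block_vec_def atLeast0LessThan)
  also have "\<dots> = (\<Sum>l\<in>(\<lambda>s. 4 * (i div 4) + s) ` {..<4}. ?h l)"
  proof (rule sum.mono_neutral_right)
    show "\<forall>l\<in>{..<N} - (\<lambda>s. 4 * (i div 4) + s) ` {..<4}. ?h l = 0"
    proof
      fix l assume l: "l \<in> {..<N} - (\<lambda>s. 4 * (i div 4) + s) ` {..<4}"
      have "l = 4 * (l div 4) + l mod 4" "l mod 4 < 4" by simp_all
      then have "l div 4 \<noteq> i div 4" using l by (metis DiffE imageI lessThan_iff)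
      then show "?h l = 0" by simp
    qed
    have "i div 4 < m" using assms by (simp add: less_mult_imp_div_less mult.commute)
    then show "(\<lambda>s. 4 * (i div 4) + s) ` {..<4} \<subseteq> {..<N}" using assms by auto
  qed simp
  also have "\<dots> = (\<Sum>s<4. ?h (4 * (i div 4) + s))"
    by (subst sum.reindex) (auto simp: inj_on_def)
  also have "\<dots> = (\<Sum>s<4. quat_entry a b c d (i mod 4) s * x $ (4 * (i div 4) + s))"
    by (intro sum.cong) auto
  finally show ?thesis .
qed

section \<open>Skew-symmetric similitudes\<close>

lemma skew_similitude_imp_sum_three_squares:
  fixes W :: "'a::linordered_field vec \<Rightarrow> 'a vec"
  assumes N: "N = 4 * (2 * m + 1)"
    and W: "\<And>x. x \<in> carrier_vec N \<Longrightarrow> W x \<in> carrier_vec N"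
    and skew: "\<And>x y. x \<in> carrier_vec N \<Longrightarrow> y \<in> carrier_vec N \<Longrightarrow> W x \<bullet> y = - (x \<bullet> W y)"
    and sim: "\<And>x y. x \<in> carrier_vec N \<Longrightarrow> y \<in> carrier_vec N \<Longrightarrow> W x \<bullet> W y = k * (x \<bullet> y)"
    and k: "k = a^2 + b^2 + c^2 + d^2" "k \<noteq> 0"
  shows "\<exists>x y z. k = x^2 + y^2 + z^2"
proof -
  \<comment> \<open>Here \<open>N = 2 * K + 4\<close>. The first \<open>K\<close> coordinates carry
    the vectors \<open>g i\<close>, the next \<open>K + 1\<close> are the unit vectors
    \<open>e i\<close>, and exactly three coordinates remain.\<close>
  define K where "K = 4 * m"
  define g where "g = quat_block_vec N a b c d"
  define e where "e i = (unit_vec N (K + i) :: 'a vec)" for i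
  have e: "e i \<in> carrier_vec N" for i by (simp add: e_def)
  have g: "g i \<in> carrier_vec N" for i by (simp add: g_def quat_block_vec_def)
  have gx: "g i \<bullet> x = (\<Sum>s<4. quat_entry a b c d (i mod 4) s * x $ (4 * (i div 4) + s))"
    if "i < K" "x \<in> carrier_vec N" for i x
    unfolding g_def using that by (intro quat_block_vec_scalar_prod[of _ m]) (auto simp: N K_def)
  have idx: "4 * (i div 4) + s < K" if "i < K" "s < 4" for i s
  proof -
    have "i div 4 < m" using that by (simp add: K_def less_mult_imp_div_less mult.commute)
    then show ?thesis using that by (simp add: K_def)
  qed
  have KN: "K \<le> N" "K + K < N" by (simp_all add: N K_def)
  have ee: "e i \<bullet> e j = (if i = j then 1 else 0)" if "i \<le> K" "j \<le> K" for i j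
    using that KN by (auto simp: e_def)
  have ge: "g j \<bullet> e i = 0" if "i \<le> K" "j < K" for i j
    unfolding gx[OF that(2) e]
  proof (intro sum.neutral ballI)
    fix s assume "s \<in> {..<4::nat}"
    then have "4 * (j div 4) + s < K" using idx that by simp
    then show "quat_entry a b c d (j mod 4) s * e i $ (4 * (j div 4) + s) = 0"
      using that KN by (simp add: e_def)
  qed
  have gg: "g i \<bullet> g j = (if i = j then k else 0)" if "i < K" "j < K" for i j
  proof -
    have entry: "g j $ (4 * (i div 4) + s)
        = (if i div 4 = j div 4 then quat_entry a b c d (j mod 4) s else 0)" if "s < 4" for s
      using idx[OF \<open>i < K\<close> that] KN that by (simp add: g_def quat_block_vec_def)
    have "g i \<bullet> g j = (\<Sum>s<4. quat_entry a b c d (i mod 4) s *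
        (if i div 4 = j div 4 then quat_entry a b c d (j mod 4) s else 0))"
      unfolding gx[OF \<open>i < K\<close> g] by (intro sum.cong) (simp_all add: entry)
    show ?thesis
    proof (cases "i div 4 = j div 4")
      case True
      then have "i = j \<longleftrightarrow> i mod 4 = j mod 4" by (metis div_mult_mod_eq)
      then show ?thesis using True \<open>g i \<bullet> g j = _\<close> by (simp add: quat_entry_rows k)
    next
      case False
      then show ?thesis using \<open>g i \<bullet> g j = _\<close> by auto
    qed
  qed
  have comm: "x \<bullet> y = y \<bullet> x" if "x \<in> carrier_vec N" "y \<in> carrier_vec N" for x y :: "'a vec"
    using that by (rule comm_scalar_prod)
  have eg: "e i \<bullet> g j = 0" if "i \<le> K" "j < K" for i j
    using ge[OF that] comm[OF e g] by simp
  obtain f where f: "\<And>i. i \<le> K \<Longrightarrow> f i \<in> carrier_vec N"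
    "\<And>i j. i \<le> K \<Longrightarrow> j \<le> K \<Longrightarrow> f i \<bullet> f j = (if i = j then 1 else 0)"
    "\<And>i j. i \<le> K \<Longrightarrow> j \<le> K \<Longrightarrow> f i \<bullet> W (f j) = 0"
    using ex_orthonormal_with_orthogonal_images[of N W k K e g "Suc K", OF W skew sim e g ee gg eg]
    by (auto simp: less_Suc_eq_le)
  have Wf: "W (f i) \<bullet> f j = 0" if "i \<le> K" "j \<le> K" for i j
    using f that by (simp add: skew)
  \<comment> \<open>Witt is now used in the opposite direction, from the \<open>f i\<close> and
    \<open>W (f i)\<close> to the model. \<open>W (f K)\<close> is left out of the matching: its
    image \<open>v\<close> has to land in the three free coordinates.\<close>
  obtain \<sigma> where \<sigma>: "\<And>x. x \<in> carrier_vec N \<Longrightarrow> \<sigma> x \<in> carrier_vec N"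
    "\<And>x y. x \<in> carrier_vec N \<Longrightarrow> y \<in> carrier_vec N \<Longrightarrow> \<sigma> x \<bullet> \<sigma> y = x \<bullet> y"
    "\<And>i. i \<le> K \<Longrightarrow> \<sigma> (f i) = e i" "\<And>i. i < K \<Longrightarrow> \<sigma> (W (f i)) = g i"
  proof (rule witt_extension[of "{..K} <+> {..<K}" "case_sum f (\<lambda>i. W (f i))" N "case_sum e g"])
    fix \<tau>
    assume \<tau>: "\<And>x. x \<in> carrier_vec N \<Longrightarrow> \<tau> x \<in> carrier_vec N"
      "\<And>x y. x \<in> carrier_vec N \<Longrightarrow> y \<in> carrier_vec N \<Longrightarrow> \<tau> x \<bullet> \<tau> y = x \<bullet> y"
      "\<And>i. i \<in> {..K} <+> {..<K} \<Longrightarrow> \<tau> (case_sum f (\<lambda>i. W (f i)) i) = case_sum e g i"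
    show thesis using that[OF \<tau>(1,2)] \<tau>(3)[of "Inl _"] \<tau>(3)[of "Inr _"] by auto
  qed (auto simp: e g f W Wf ee gg eg ge sim split: if_splits)
  define v where "v = \<sigma> (W (f K))"
  have v: "v \<in> carrier_vec N" using \<sigma> W f by (simp add: v_def)
  have vv: "v \<bullet> v = k" using \<sigma>(2)[of "W (f K)" "W (f K)"] W f sim by (simp add: v_def)
  have "e i \<bullet> v = 0" if "i \<le> K" for i
    using \<sigma>(2)[of "f i" "W (f K)"] \<sigma>(3)[of i] f W that by (simp add: v_def)
  then have v1: "v $ (K + i) = 0" if "i \<le> K" for i
    using that v KN by (simp add: e_def)
  have gv: "g i \<bullet> v = 0" if "i < K" for i
    using \<sigma>(2)[of "W (f i)" "W (f K)"] \<sigma>(4)[of i] f W that by (simp add: v_def sim)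
  \<comment> \<open>Orthogonality to the four vectors \<open>g\<close> of a block says that the
    block annihilates the matching part of \<open>v\<close>. As \<open>k\<close> is nonzero, that
    part is zero.\<close>
  have v2: "v $ l = 0" if "l < K" for l
  proof -
    have "(\<Sum>s<4. quat_entry a b c d r s * v $ (4 * (l div 4) + s)) = 0" if "r < 4" for r
      using gx[of "4 * (l div 4) + r" v] gv[of "4 * (l div 4) + r"] idx[OF \<open>l < K\<close> that] that v by simp
    then have "k * v $ (4 * (l div 4) + l mod 4) = 0"
      unfolding k(1) by (rule quat_entry_kernel) simp_all
    then show ?thesis using k(2) by simp
  qed
  have v0: "v $ l = 0" if "l < K + K + 1" for l
  proof (cases "l < K")
    case False
    then show ?thesis using v1[of "l - K"] that by simp
  qed (rule v2)
  have "k = (\<Sum>l<N. v $ l * v $ l)"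
    using v by (simp add: vv[symmetric] scalar_prod_def atLeast0LessThan)
  also have "\<dots> = (\<Sum>l\<in>{K + K + 1, K + K + 2, K + K + 3}. v $ l * v $ l)"
    by (rule sum.mono_neutral_right) (auto simp: N K_def intro!: v0)
  finally have "k = (v $ (K + K + 1))^2 + (v $ (K + K + 2))^2 + (v $ (K + K + 3))^2"
    by (simp add: power2_eq_square)
  then show ?thesis by blast
qed

text \<open>Reading the matrix over the rationals provides the field that reflections require. Its
  two defining identities become skewness and similitude of the map \<open>x\<close> to
  \<open>A *\<^sub>v x\<close>, and odd \<open>n\<close> gives the dimension
  \<open>4 * (2 * m + 1)\<close>.\<close>

lemma skew_weighing_imp_sum_three_squares:
  fixes k n :: nat and W :: "int mat"
  assumes "weighing_matrix (4 * n) k W" "skew_symmetric_mat W" "odd n" "k > 0"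
    "(of_nat k :: rat) = a^2 + b^2 + c^2 + d^2"
  shows "\<exists>x y z :: rat. of_nat k = x^2 + y^2 + z^2"
proof -
  define N where "N = 4 * n"
  define A where "A = map_mat (of_int :: int \<Rightarrow> rat) W"
  have W: "W \<in> carrier_mat N N" "W * transpose_mat W = of_nat k \<cdot>\<^sub>m 1\<^sub>m N" "transpose_mat W = - W"
    using assms by (auto simp: weighing_matrix_def skew_symmetric_mat_def N_def)
  have A: "A \<in> carrier_mat N N" using W by (simp add: A_def)
  have At: "transpose_mat A = - A"
  proof -
    have "transpose_mat A = map_mat of_int (transpose_mat W)" by (auto simp add: A_def)
    then show ?thesis unfolding W(3) by (auto simp: A_def)
  qed
  have "A * transpose_mat A = map_mat of_int (W * transpose_mat W)"
    using W(1) by (simp add: A_def map_mat_transpose of_int_hom.mat_hom_mult[of _ N N _ N])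
  also have "\<dots> = of_nat k \<cdot>\<^sub>m 1\<^sub>m N" unfolding W(2) by (auto simp: one_mat_def)
  \<comment> \<open>Skew-symmetry makes \<open>A\<close> commute with its transpose, so the row
    identity is also the column identity.\<close>
  finally have "transpose_mat A * A = of_nat k \<cdot>\<^sub>m 1\<^sub>m N" using A by (simp add: At)
  then have AA: "transpose_mat A *\<^sub>v (A *\<^sub>v y) = of_nat k \<cdot>\<^sub>v y" if "y \<in> carrier_vec N" for y
    using A that by (auto simp flip: assoc_mult_mat_vec[of _ N N _ N])
  obtain m where "n = 2 * m + 1" using \<open>odd n\<close> by (blast elim: oddE)
  have adj: "(A *\<^sub>v x) \<bullet> y = x \<bullet> (transpose_mat A *\<^sub>v y)" if "x \<in> carrier_vec N" "y \<in> carrier_vec N" for x y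
    using transpose_vec_mult_scalar[of A N N x y] A that
    by (metis comm_scalar_prod mult_mat_vec_carrier transpose_carrier_mat)
  show ?thesis
  proof (rule skew_similitude_imp_sum_three_squares[of N m "\<lambda>x. A *\<^sub>v x"])
    show "N = 4 * (2 * m + 1)" by (simp add: N_def \<open>n = 2 * m + 1\<close>)
    show "(A *\<^sub>v x) \<bullet> y = - (x \<bullet> (A *\<^sub>v y))" if "x \<in> carrier_vec N" "y \<in> carrier_vec N" for x y
      using A that by (simp add: adj At)
    show "(A *\<^sub>v x) \<bullet> (A *\<^sub>v y) = of_nat k * (x \<bullet> y)" if "x \<in> carrier_vec N" "y \<in> carrier_vec N" for x y
      using A that by (simp add: adj AA)
  qed (use A assms in auto)
qed

theorem theorem2p10:
  fixes k n :: nat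
  assumes "k > 0"
    and "\<not> (\<exists>a b c :: int. int k = a^2 + b^2 + c^2)"
    and "n > 0" and "odd n"
  shows "\<not> (\<exists>W. weighing_matrix (4 * n) k W \<and> skew_symmetric_mat W)"
proof
  assume "\<exists>W. weighing_matrix (4 * n) k W \<and> skew_symmetric_mat W"
  then obtain W where W: "weighing_matrix (4 * n) k W" "skew_symmetric_mat W" by blast
  obtain a b c d :: rat where "of_nat k = a^2 + b^2 + c^2 + d^2"
    using rat_of_nat_sum_four_squares[of k] unfolding sum_four_squares_def by blast
  from skew_weighing_imp_sum_three_squares[OF W \<open>odd n\<close> \<open>k > 0\<close> this]
  obtain x y z :: rat where "of_int (int k) = x^2 + y^2 + z^2" by (metis of_int_of_nat_eq)
  then show False using rat_sum_three_squares_imp_int assms(2) by blast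
qed

end
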